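(* Let $Q\subseteq\mathbb{R}^n_+$ be a well-behaved packing set. Then: 1. $\displaystyle \operatorname{rank}_{\mathcal{S}}(Q)\ \ge\ \sup_{c\in\mathbb{R}^n_+}\left\lceil \log_2\left(\frac{z^{LP}(c)}{z^{I}(c)}\right)\right\rceil.$ 2. $\displaystyle \operatorname{rank}_{\mathcal{S}^k}(Q)\ \ge\ \sup_{c\in\mathbb{R}^n_+}\left\lceil \frac{\log_2\left(\frac{z^{LP}(c)}{z^{I}(c)}\right)}{\log_2(\min\{2^k,n\}+1)}\right\rceil$ for any integer $k\ge 1$. 3. $\displaystyle \operatorname{rank}_{\mathcal{L}^k}(Q)\ \ge\ \sup_{c\in\mathbb{R}^n_+}\left\lceil \frac{\log_2\left(\frac{z^{LP}(c)}{z^{I}(c)}\right)}{\log_2(\min\{k,n\}+1)}\right\rceil$ for any integer $k\ge 2$.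
   Context: A set $Q\subseteq\mathbb{R}^n_+$ is a packing set if $x\in Q$ and $\mathbf{0}\le y\le x$ (componentwise) imply $y\in Q$. It is well-behaved if every unit vector $e_j$, $j\in\{1,\dots,n\}$, belongs to $Q$. For $c\in\mathbb{R}^n_+$, $z^{LP}(c)$ and $z^I(c)$ denote the optimal values of maximizing $c^\top x$ over $Q$ and over $Q^I$, respectively, where $Q^I=\operatorname{conv}(Q\cap\mathbb{Z}^n)$ is the integer hull. Split set: for $(\pi,\pi_0)\in\mathbb{Z}^n\times\mathbb{Z}$, $S(\pi,\pi_0)=\{x\in\mathbb{R}^n:\pi_0<\pi^\top x<\pi_0+1\}$. For a set $Q$: - split closure: $\mathcal{S}(Q)=\bigcap_{(\pi,\pi_0)\in\mathbb{Z}^n\times\mathbb{Z}}\operatorname{conv}(Q\setminus S(\pi,\pi_0))$; - $k$-branch split closure ($k\ge1$): $\mathcal{S}^k(Q)=\bigcap \operatorname{conv}\big(Q\setminus\bigcup_{i=1}^k S(\pi^i,\pi^i_0)\big)$, the intersection being over all $(\pi^i,\pi^i_0)\in\mathbb{Z}^n\times\mathbb{Z}$, $i=1,\dots,k$; - $k$-lattice-free closure ($k\ge2$): $\mathcal{L}^k(Q)=\bigcap_{L}\operatorname{conv}(Q\setminus\operatorname{int}(L))$, the intersection being over all full-dimensional polyhedra $L\subset\mathbb{R}^n$ defined by at most $k$ linear inequalities and with $\operatorname{int}(L)\cap\mathbb{Z}^n=\emptyset$. For a closure operator $\mathcal{M}\in\{\mathcal{S},\mathcal{S}^k,\mathcal{L}^k\}$,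 $\operatorname{rank}_{\mathcal{M}}(Q)$ is the minimum number of iterated applications of $\mathcal{M}$, starting from $Q$, needed to obtain $Q^I$. *)

theory Defs
  imports "HOL-Analysis.Analysis"
begin

definition packing_set :: "(real ^ 'n) set \<Rightarrow> bool" where
  "packing_set Q \<longleftrightarrow> (\<forall>x\<in>Q. 0 \<le> x) \<and> (\<forall>x\<in>Q. \<forall>y. 0 \<le> y \<and> y \<le> x \<longrightarrow> y \<in> Q)"

definition well_behaved :: "(real ^ 'n) set \<Rightarrow> bool" where
  "well_behaved Q \<longleftrightarrow> (\<forall>j. axis j 1 \<in> Q)"

definition int_points :: "(real ^ 'n) set" where
  "int_points = {x. \<forall>j. x $ j \<in> \<int>}"

definition int_hull :: "(real ^ 'n) set \<Rightarrow> (real ^ 'n) set" where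
  "int_hull Q = convex hull (Q \<inter> int_points)"

text \<open>Optimal values are extended real: \<open>Q\<close> need not be bounded, and the supremum need not
  be attained.\<close>

definition max_value :: "(real ^ 'n) set \<Rightarrow> real ^ 'n \<Rightarrow> ereal" where
  "max_value Q c = (SUP x\<in>Q. ereal (c \<bullet> x))"

definition zLP :: "(real ^ 'n) set \<Rightarrow> real ^ 'n \<Rightarrow> ereal" where
  "zLP Q c = max_value Q c"

definition zI :: "(real ^ 'n) set \<Rightarrow> real ^ 'n \<Rightarrow> ereal" where
  "zI Q c = max_value (int_hull Q) c"

definition split_set :: "int ^ 'n \<Rightarrow> int \<Rightarrow> (real ^ 'n) set" where
  "split_set p p0 = {x. of_int p0 < (\<chi> j. of_int (p $ j)) \<bullet> x \<and>
                        (\<chi> j. of_int (p $ j)) \<bullet> x < of_int p0 + 1}"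

definition split_closure :: "(real ^ 'n) set \<Rightarrow> (real ^ 'n) set" where
  "split_closure Q = (\<Inter>p. \<Inter>p0. convex hull (Q - split_set p p0))"

text \<open>The families below are indexed by all of \<open>nat\<close>, but only their values at
  \<open>1, \<dots>, k\<close> are used.\<close>

definition branch_split_closure :: "nat \<Rightarrow> (real ^ 'n) set \<Rightarrow> (real ^ 'n) set" where
  "branch_split_closure k Q =
     (\<Inter>(p :: nat \<Rightarrow> int ^ 'n). \<Inter>(p0 :: nat \<Rightarrow> int).
        convex hull (Q - (\<Union>i\<in>{1..k}. split_set (p i) (p0 i))))"

text \<open>A pair \<open>(a, b)\<close> stands for the inequality \<open>a \<bullet> x \<le> b\<close>. The data need not be
  rational.\<close>

definition lattice_free_polyhedron :: "nat \<Rightarrow> (real ^ 'n) set \<Rightarrow> bool" where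
  "lattice_free_polyhedron k L \<longleftrightarrow>
     (\<exists>H :: ((real ^ 'n) \<times> real) set.
        finite H \<and> card H \<le> k \<and> L = {x. \<forall>(a, b)\<in>H. a \<bullet> x \<le> b}) \<and>
     aff_dim L = int CARD('n) \<and>
     interior L \<inter> int_points = {}"

definition lattice_free_closure :: "nat \<Rightarrow> (real ^ 'n) set \<Rightarrow> (real ^ 'n) set" where
  "lattice_free_closure k Q =
     (\<Inter>L\<in>{L. lattice_free_polyhedron k L}. convex hull (Q - interior L))"

text \<open>The rank is \<open>\<infinity>\<close> (the infimum of the empty set) if no number of iterations yields the
  integer hull.\<close>

definition closure_rank ::
  "((real ^ 'n) set \<Rightarrow> (real ^ 'n) set) \<Rightarrow> (real ^ 'n) set \<Rightarrow> enat" where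
  "closure_rank M Q = (INF m\<in>{m. (M ^^ m) Q = int_hull Q}. enat m)"

text \<open>Base-2 logarithm and ceiling on the extended reals. Division on \<^typ>\<open>ereal\<close> gives
  \<open>0 / 0 = 0\<close> and \<open>\<infinity> / \<infinity> = 0\<close>; since \<open>log2_ereal 0 = - \<infinity>\<close>, an objective \<open>c\<close> for which the
  ratio of the two optimal values is undefined (\<open>c = 0\<close>, or both values infinite) contributes
  only \<open>- \<infinity>\<close> to a supremum, that is, nothing.\<close>

definition log2_ereal :: "ereal \<Rightarrow> ereal" where
  "log2_ereal x = (case x of
       ereal r \<Rightarrow> if r > 0 then ereal (log 2 r) else - \<infinity>
     | PInfty \<Rightarrow> \<infinity>
     | MInfty \<Rightarrow> - \<infinity>)"

definition ceiling_ereal :: "ereal \<Rightarrow> ereal" where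
  "ceiling_ereal x = (case x of
       ereal r \<Rightarrow> ereal (of_int \<lceil>r\<rceil>)
     | PInfty \<Rightarrow> \<infinity>
     | MInfty \<Rightarrow> - \<infinity>)"

end

theory Submission
  imports Defs
begin

text \<open>One application of a closure loses at most a factor \<open>\<alpha>\<close>: if \<open>P\<close> is a well-behaved packing set,
  \<open>x \<in> P\<close> and \<open>C\<close> is one of the removed sets, then \<open>x / \<alpha> \<in> conv(P \ C)\<close>. For the interior of a
  lattice-free polyhedron with \<open>k\<close> inequalities, write \<open>x\<close> as a sum of pieces lying in
  \<open>\<alpha>\<^sub>i conv(P \ C)\<close>. As long as some inequality is violated by a restriction of \<open>x\<close> to a set of
  coordinates and cannot be violated by integer points on the other coordinates, split off that
  restriction as a piece of cost 1. When this stops, a basic solution of the remaining system has few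
  nonzero entries, and if \<open>x\<close> were too expensive, then rounding it down would give an integer point in
  \<open>C\<close>. A union of \<open>k\<close> splits leaves at most \<open>2\<^sup>k\<close> convex cells; if a hyperplane
  separates \<open>x / \<alpha>\<close> from the hull, then separating its side of the box \<open>[0, x]\<close> from each cell yields
  a lattice-free set with \<open>2\<^sup>k\<close> inequalities. A single split is treated by hand.

  The hulls \<open>conv(P \ C)\<close> need not be packing sets, so the factors are accumulated on the packing
  sets \<open>\<alpha>\<^sup>-\<^sup>m Q \<union> \<Union>\<^sub>j [0, e\<^sub>j]\<close>, which lie in the \<open>m\<close>-th closure by monotonicity.\<close>

section \<open>Basic solutions of linear systems\<close>

text \<open>Gaussian elimination, by induction on the number of equations: a nonzero coefficient
  serves as a pivot and removes one equation together with one unknown.\<close>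

lemma nontrivial_solution:
  fixes g :: "'i \<Rightarrow> 'j \<Rightarrow> real"
  assumes "finite I" "finite S" "card I < card S"
  shows "\<exists>d. (\<exists>j\<in>S. d j \<noteq> 0) \<and> (\<forall>i\<in>I. (\<Sum>j\<in>S. g i j * d j) = 0)"
  using assms
proof (induction I arbitrary: S g rule: finite_induct)
  case empty
  then obtain j where "j \<in> S" by fastforce
  then show ?case by (intro exI[of _ "\<lambda>_. 1"]) auto
next
  case (insert i I)
  show ?case
  proof (cases "\<forall>j\<in>S. g i j = 0")
    case True
    obtain d where "\<exists>j\<in>S. d j \<noteq> 0" "\<forall>i\<in>I. (\<Sum>j\<in>S. g i j * d j) = 0"
      using insert.IH[of S g] insert.hyps insert.prems by (metis Suc_lessD card_insert_disjoint)
    then show ?thesis using True by (intro exI[of _ d]) auto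
  next
    case False
    then obtain p where p: "p \<in> S" "g i p \<noteq> 0" by auto
    define h where "h = (\<lambda>i' j. g i' j - g i' p * g i j / g i p)"
    have "card I < card (S - {p})" using insert p by simp
    then obtain d where d: "\<exists>j\<in>S - {p}. d j \<noteq> 0"
        "\<forall>i\<in>I. (\<Sum>j\<in>S - {p}. h i j * d j) = 0"
      using insert.IH[of "S - {p}" h] insert.prems by auto
    define s where "s = (\<Sum>j\<in>S - {p}. g i j * d j)"
    \<comment> \<open>The entry at the pivot is chosen so that equation \<open>i\<close> holds; the
      passage from \<open>g\<close> to \<open>h\<close> is what makes the other equations carry
      over.\<close>
    define e where "e = d(p := - s / g i p)"
    have e: "(\<Sum>j\<in>S. g i' j * e j) = (\<Sum>j\<in>S - {p}. g i' j * d j) - g i' p * s / g i p" for i'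
      by (subst sum.remove[OF \<open>finite S\<close> p(1)]) (simp add: e_def)
    have "(\<Sum>j\<in>S. g i' j * e j) = 0" if "i' \<in> I" for i'
    proof -
      have "(\<Sum>j\<in>S - {p}. h i' j * d j) = (\<Sum>j\<in>S - {p}. g i' j * d j) - g i' p * s / g i p"
        unfolding h_def s_def
        by (simp add: left_diff_distrib sum_subtractf sum_distrib_left sum_divide_distrib mult.assoc)
      then show ?thesis using e d that by simp
    qed
    moreover have "(\<Sum>j\<in>S. g i j * e j) = 0" using e p by (simp add: s_def)
    moreover have "\<exists>j\<in>S. e j \<noteq> 0" using d by (auto simp: e_def)
    ultimately show ?thesis by auto
  qed
qed

text \<open>As long as the support has more elements than there are equations, a kernel direction on
  the support allows a move that preserves all sums and keeps the entries nonnegative until one of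
  them vanishes.\<close>

lemma conic_caratheodory:
  fixes g :: "'i \<Rightarrow> 'j \<Rightarrow> real"
  assumes "finite I" "finite S" "\<And>j. j \<in> S \<Longrightarrow> 0 \<le> x j"
  shows "\<exists>y. (\<forall>j\<in>S. 0 \<le> y j) \<and> card {j\<in>S. y j \<noteq> 0} \<le> card I \<and>
    (\<forall>i\<in>I. (\<Sum>j\<in>S. g i j * y j) = (\<Sum>j\<in>S. g i j * x j))"
  using assms(3)
proof (induction "card {j\<in>S. x j \<noteq> 0}" arbitrary: x rule: less_induct)
  case less
  define T where "T = {j\<in>S. x j \<noteq> 0}"
  have finT: "finite T" and TS: "T \<subseteq> S" using assms(2) by (auto simp: T_def)
  show ?case
  proof (cases "card T \<le> card I")
    case True
    then show ?thesis using less.prems by (intro exI[of _ x]) (auto simp: T_def)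
  next
    case False
    then obtain d0 where d0: "\<exists>j\<in>T. d0 j \<noteq> 0" "\<forall>i\<in>I. (\<Sum>j\<in>T. g i j * d0 j) = 0"
      using nontrivial_solution[OF assms(1) finT, of g] by auto
    have "\<exists>d. (\<exists>j\<in>T. d j > 0) \<and> (\<forall>i\<in>I. (\<Sum>j\<in>T. g i j * d j) = 0)"
    proof (cases "\<exists>j\<in>T. d0 j > 0")
      case True
      then show ?thesis using d0 by auto
    next
      case False
      then have "\<exists>j\<in>T. - d0 j > 0" using d0 by force
      then show ?thesis using d0
        by (intro exI[of _ "\<lambda>j. - d0 j"]) (auto simp: sum_negf)
    qed
    then obtain d where d: "\<exists>j\<in>T. d j > 0" "\<forall>i\<in>I. (\<Sum>j\<in>T. g i j * d j) = 0" by auto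
    define D where "D = {j\<in>T. d j > 0}"
    \<comment> \<open>Ratio test: \<open>t\<close> is the largest step along \<open>- d\<close> that
      keeps the entries nonnegative, and an entry attaining the minimum becomes zero. The sign of
      \<open>d\<close> was arranged so that \<open>D\<close> is nonempty.\<close>
    define t where "t = Min ((\<lambda>j. x j / d j) ` D)"
    have D: "finite D" "D \<noteq> {}" using finT d by (auto simp: D_def)
    then have "t \<in> (\<lambda>j. x j / d j) ` D" unfolding t_def by (intro Min_in) auto
    then obtain p where p: "p \<in> D" "t = x p / d p" by auto
    have t_le: "t \<le> x j / d j" if "j \<in> D" for j
      unfolding t_def using D that by (intro Min_le) auto
    have "t \<ge> 0" using p less.prems TS by (auto simp: D_def)
    define x' where "x' = (\<lambda>j. if j \<in> T then x j - t * d j else x j)"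
    have x'_nonneg: "0 \<le> x' j" if "j \<in> S" for j
    proof (cases "j \<in> D")
      case True
      then show ?thesis using t_le[OF True] less.prems[OF that]
        by (auto simp: x'_def D_def field_simps)
    next
      case False
      then have "j \<in> T \<Longrightarrow> t * d j \<le> 0" using \<open>t \<ge> 0\<close>
        by (auto simp: D_def mult_nonneg_nonpos)
      then show ?thesis using less.prems[OF that] by (auto simp: x'_def)
    qed
    have "{j\<in>S. x' j \<noteq> 0} \<subseteq> T - {p}" using p by (auto simp: x'_def T_def D_def)
    moreover have "p \<in> T" using p by (auto simp: D_def)
    ultimately have "card {j\<in>S. x' j \<noteq> 0} < card T"
      using finT by (metis card_Diff1_less card_mono finite_Diff order_le_less_trans)
    then obtain y where y: "\<forall>j\<in>S. 0 \<le> y j" "card {j\<in>S. y j \<noteq> 0} \<le> card I"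
        "\<forall>i\<in>I. (\<Sum>j\<in>S. g i j * y j) = (\<Sum>j\<in>S. g i j * x' j)"
      using less.hyps[of x'] x'_nonneg unfolding T_def by blast
    have "(\<Sum>j\<in>S. g i j * x' j) = (\<Sum>j\<in>S. g i j * x j)" if "i \<in> I" for i
    proof -
      have "(\<Sum>j\<in>S. g i j * x' j) = (\<Sum>j\<in>S. g i j * x j - (if j \<in> T then t * (g i j * d j) else 0))"
        by (intro sum.cong) (auto simp: x'_def algebra_simps)
      also have "\<dots> = (\<Sum>j\<in>S. g i j * x j) - (\<Sum>j\<in>T. t * (g i j * d j))"
        using TS assms(2) by (simp add: sum_subtractf sum.If_cases Int_absorb1)
      also have "(\<Sum>j\<in>T. t * (g i j * d j)) = 0"
        using d that by (simp flip: sum_distrib_left)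
      finally show ?thesis by simp
    qed
    then show ?thesis using y by (intro exI[of _ y]) auto
  qed
qed

section \<open>Scaling into the hull of a lattice-free complement\<close>

definition restrict_vec :: "'n set \<Rightarrow> real ^ 'n \<Rightarrow> real ^ 'n" where
  "restrict_vec R x = (\<chi> j. if j \<in> R then x $ j else 0)"

lemma inner_restrict_vec: "a \<bullet> restrict_vec R x = (\<Sum>j\<in>R. a $ j * x $ j)"
proof -
  have "a \<bullet> restrict_vec R x = (\<Sum>j\<in>UNIV. if j \<in> R then a $ j * x $ j else 0)"
    unfolding inner_vec_def restrict_vec_def by (intro sum.cong) auto
  then show ?thesis by (simp add: sum.If_cases)
qed

lemma restrict_vec_bounds:
  assumes "0 \<le> x" shows "0 \<le> restrict_vec R x" "restrict_vec R x \<le> x"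
  using assms by (auto simp: restrict_vec_def less_eq_vec_def)

lemma restrict_vec_Diff:
  "F \<subseteq> R \<Longrightarrow> restrict_vec R x = restrict_vec F x + restrict_vec (R - F) x"
  by (auto simp: restrict_vec_def vec_eq_iff)

text \<open>The weights \<open>s / (s + t)\<close> and \<open>t / (s + t)\<close> combine the two
  points of \<open>Z\<close>. If membership in the \<open>s\<close>-fold dilate of \<open>Z\<close>
  is read as having cost \<open>s\<close>, then costs of summands add up.\<close>

lemma convex_scaling_add:
  fixes Z :: "'a::real_vector set"
  assumes "convex Z" "s \<ge> 0" "t \<ge> 0" "u \<in> (*\<^sub>R) s ` Z" "v \<in> (*\<^sub>R) t ` Z"
  shows "u + v \<in> (*\<^sub>R) (s + t) ` Z"
proof -
  obtain p q where pq: "p \<in> Z" "q \<in> Z" "u = s *\<^sub>R p" "v = t *\<^sub>R q" using assms by auto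
  show ?thesis
  proof (cases "s + t = 0")
    case True
    then have "s = 0" "t = 0" using assms by auto
    then show ?thesis using pq by auto
  next
    case False
    then have pos: "s + t > 0" using assms by auto
    have "(s / (s + t)) *\<^sub>R p + (t / (s + t)) *\<^sub>R q \<in> Z"
      using assms pq pos by (intro convexD) (auto simp flip: add_divide_distrib)
    moreover have "u + v = (s + t) *\<^sub>R ((s / (s + t)) *\<^sub>R p + (t / (s + t)) *\<^sub>R q)"
      using pos pq by (simp add: scaleR_add_right)
    ultimately show ?thesis by blast
  qed
qed

text \<open>The missing factor \<open>t - s\<close> is filled up with a multiple of
  \<open>0\<close>, so the dilates are nested.\<close>

lemma convex_scaling_mono:
  fixes Z :: "'a::real_vector set"
  assumes "convex Z" "0 \<in> Z" "0 \<le> s" "s \<le> t" "u \<in> (*\<^sub>R) s ` Z"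
  shows "u \<in> (*\<^sub>R) t ` Z"
proof -
  have "0 \<in> (*\<^sub>R) (t - s) ` Z" using assms(2) by force
  then show ?thesis using convex_scaling_add[OF assms(1), of s "t - s" u 0] assms by auto
qed

text \<open>Each coordinate is paid for separately: \<open>x $ j\<close> times a unit vector costs
  \<open>x $ j\<close>.\<close>

lemma restrict_vec_in_simplex_scaling:
  assumes "convex Z" "0 \<in> Z" "\<And>j. axis j 1 \<in> Z" "0 \<le> x"
  shows "restrict_vec R x \<in> (*\<^sub>R) (\<Sum>j\<in>R. x $ j) ` Z"
proof -
  have "finite R" by simp
  then show ?thesis
  proof (induction R rule: finite_induct)
    case empty
    have "restrict_vec {} x = 0" by (simp add: restrict_vec_def vec_eq_iff)
    then show ?case using assms by auto
  next
    case (insert j R)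
    have nn: "0 \<le> x $ i" for i using assms by (auto simp: less_eq_vec_def)
    have "restrict_vec (insert j R) x = x $ j *\<^sub>R axis j 1 + restrict_vec R x"
      using insert by (auto simp: restrict_vec_def vec_eq_iff axis_def)
    moreover have "x $ j *\<^sub>R axis j 1 \<in> (*\<^sub>R) (x $ j) ` Z" using assms by blast
    ultimately show ?case
      using convex_scaling_add[OF assms(1) nn[of j] _ _ insert.IH] insert nn
      by (simp add: sum_nonneg)
  qed
qed

text \<open>\<open>I\<close> is the set of inequalities still active on the coordinates in \<open>R\<close>: the others hold strictly
  at every nonzero nonnegative integer point supported on \<open>R\<close>.\<close>

lemma lattice_free_scaling_restrict:
  fixes Z :: "(real ^ 'n) set" and H :: "((real ^ 'n) \<times> real) set"
  assumes Z: "convex Z" "0 \<in> Z" "\<And>j. axis j 1 \<in> Z"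
    and x: "0 \<le> x"
    and out: "\<And>a b y. (a, b) \<in> H \<Longrightarrow> 0 \<le> y \<Longrightarrow> y \<le> x \<Longrightarrow> b \<le> a \<bullet> y \<Longrightarrow> y \<in> Z"
    and free: "\<And>y. y \<in> int_points \<Longrightarrow> 0 \<le> y \<Longrightarrow> y \<noteq> 0 \<Longrightarrow> \<exists>(a, b)\<in>H. b \<le> a \<bullet> y"
    and "finite I" "I \<subseteq> H"
    and sat: "\<And>a b y. (a, b) \<in> H - I \<Longrightarrow> y \<in> int_points \<Longrightarrow> 0 \<le> y \<Longrightarrow> y \<noteq> 0 \<Longrightarrow>
       \<forall>j. j \<notin> R \<longrightarrow> y $ j = 0 \<Longrightarrow> a \<bullet> y < b"
  shows "restrict_vec R x \<in> (*\<^sub>R) (real (min (card I) (card R)) + 1) ` Z"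
  using assms(7-)
proof (induction "card I" arbitrary: I R rule: less_induct)
  case less
  note finI = less.prems(1) and IH = less.prems(2) and sat = less.prems(3)
  have xn: "0 \<le> x $ j" for j using x by (auto simp: less_eq_vec_def)
  define K where "K = min (card I) (card R)"
  \<comment> \<open>Inequalities outside \<open>I\<close> hold strictly at such a point, so the one
    provided by \<open>free\<close> must be active.\<close>
  have viol: "\<exists>(a, b)\<in>I. b \<le> a \<bullet> y"
    if "y \<in> int_points" "0 \<le> y" "y \<noteq> 0" "\<forall>j. j \<notin> R \<longrightarrow> y $ j = 0" for y
    using free[OF that(1-3)] sat[OF _ that] by fastforce
  show ?case
  proof (cases "\<exists>a b F. (a, b) \<in> I \<and> F \<subseteq> R \<and> b \<le> a \<bullet> restrict_vec F x \<and>
      (\<forall>y\<in>int_points. 0 \<le> y \<longrightarrow> y \<noteq> 0 \<longrightarrow> (\<forall>j. j \<notin> R - F \<longrightarrow> y $ j = 0) \<longrightarrow> a \<bullet> y < b)")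
    case True
    then obtain a b F where F: "(a, b) \<in> I" "F \<subseteq> R" "b \<le> a \<bullet> restrict_vec F x"
      "\<And>y. y \<in> int_points \<Longrightarrow> 0 \<le> y \<Longrightarrow> y \<noteq> 0 \<Longrightarrow> \<forall>j. j \<notin> R - F \<longrightarrow> y $ j = 0 \<Longrightarrow> a \<bullet> y < b"
      by blast
    have cI: "card I > 0" using F(1) finI by (auto simp: card_gt_0_iff)
    have card: "card (I - {(a, b)}) = card I - 1" using F(1) by simp
    \<comment> \<open>On \<open>R - F\<close> the inequality \<open>(a, b)\<close> is no longer
      active, so the induction hypothesis applies with one inequality less.\<close>
    have "restrict_vec (R - F) x \<in>
      (*\<^sub>R) (real (min (card (I - {(a, b)})) (card (R - F))) + 1) ` Z"
    proof (rule less.hyps)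
      fix a' b' y
      assume y: "(a', b') \<in> H - (I - {(a, b)})" "y \<in> int_points" "0 \<le> y" "y \<noteq> 0"
        "\<forall>j. j \<notin> R - F \<longrightarrow> y $ j = 0"
      then show "a' \<bullet> y < b'" using F(4)[OF y(2-5)] sat[of a' b' y] by auto
    qed (use cI card finI IH in auto)
    moreover have "restrict_vec F x \<in> (*\<^sub>R) (if F = {} then 0 else 1) ` Z"
    proof (cases "F = {}")
      case True
      then have "restrict_vec F x = 0" by (simp add: restrict_vec_def vec_eq_iff)
      then show ?thesis using True Z(2) by auto
    next
      case False
      then show ?thesis using out[of a b, OF _ restrict_vec_bounds[OF x] F(3)] F(1) IH by auto
    qed
    ultimately have "restrict_vec R x \<in> (*\<^sub>R) ((if F = {} then 0 else 1) +
        (real (min (card (I - {(a, b)})) (card (R - F))) + 1)) ` Z"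
      unfolding restrict_vec_Diff[OF F(2)] by (intro convex_scaling_add[OF Z(1)]) auto
    \<comment> \<open>A nonempty \<open>F\<close> costs 1, but then both cardinalities drop by at
      least one, and so does their minimum. An empty \<open>F\<close> costs nothing.\<close>
    moreover have "(if F = {} then 0 else 1) + min (card (I - {(a, b)})) (card (R - F)) \<le> K"
    proof (cases "F = {}")
      case False
      then have "card (R - F) < card R" using F(2) by (intro psubset_card_mono) auto
      then show ?thesis using False card cI by (auto simp: K_def)
    qed (use card cI in \<open>auto simp: K_def\<close>)
    ultimately show ?thesis
      unfolding K_def[symmetric] by (elim convex_scaling_mono[OF Z(1,2), rotated 2]) (auto split: if_splits)
  next
    case False
    then have keep: "\<not> (b \<le> a \<bullet> restrict_vec F x)" if "(a, b) \<in> I" "F \<subseteq> R"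
      "\<And>y. y \<in> int_points \<Longrightarrow> 0 \<le> y \<Longrightarrow> y \<noteq> 0 \<Longrightarrow> \<forall>j. j \<notin> R - F \<longrightarrow> y $ j = 0 \<Longrightarrow> a \<bullet> y < b"
      for a b F using that by blast
    have pos: "b > 0 \<and> (\<Sum>j\<in>R. max (a $ j) 0 * x $ j) < b" if ab: "(a, b) \<in> I" "b \<ge> 0" for a b
    proof -
      \<comment> \<open>Outside \<open>F\<close> the coefficients are at most 0, hence
        \<open>a \<bullet> y \<le> 0\<close>. For \<open>b = 0\<close> the zero coefficients are put
        into \<open>F\<close> as well, which makes the inequality strict at nonzero points; this
        case is then refuted because the sum over \<open>F\<close> is nonnegative.\<close>
      define F where "F = {j\<in>R. if b = 0 then a $ j \<ge> 0 else a $ j > 0}"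
      have "\<not> (b \<le> a \<bullet> restrict_vec F x)"
      proof (rule keep[OF ab(1)])
        fix y :: "real ^ 'n"
        assume y: "0 \<le> y" "y \<noteq> 0" "\<forall>j. j \<notin> R - F \<longrightarrow> y $ j = 0"
        have yn: "0 \<le> y $ j" for j using y by (auto simp: less_eq_vec_def)
        have le: "a $ j * y $ j \<le> 0" for j
        proof (cases "j \<in> R - F")
          case True
          then have "a $ j \<le> 0" by (auto simp: F_def split: if_splits)
          then show ?thesis using yn[of j] by (simp add: mult_nonpos_nonneg)
        qed (use y in auto)
        show "a \<bullet> y < b"
        proof (cases "b = 0")
          case True
          obtain i where "y $ i \<noteq> 0" using y(2) by (auto simp: vec_eq_iff)
          then have "i \<in> R - F" "y $ i > 0" using y(3) yn[of i] by auto
          then have "a $ i * y $ i < 0" using True by (auto simp: F_def mult_neg_pos)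
          then have "(\<Sum>j\<in>UNIV. a $ j * y $ j) < (\<Sum>j\<in>(UNIV :: 'n set). 0)"
            using le by (intro sum_strict_mono_ex1) auto
          then show ?thesis using True by (simp add: inner_vec_def)
        next
          case False
          have "a \<bullet> y \<le> 0" unfolding inner_vec_def using le by (auto intro: sum_nonpos)
          then show ?thesis using False ab by auto
        qed
      qed (auto simp: F_def)
      then have lt: "(\<Sum>j\<in>F. a $ j * x $ j) < b" by (simp add: inner_restrict_vec)
      have "(\<Sum>j\<in>R. max (a $ j) 0 * x $ j) = (\<Sum>j\<in>F. a $ j * x $ j)"
        by (intro sum.mono_neutral_cong_right) (auto simp: F_def max_def split: if_splits)
      moreover have "(\<Sum>j\<in>F. a $ j * x $ j) \<ge> 0"
        using xn by (intro sum_nonneg) (auto simp: F_def split: if_splits)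
      ultimately show ?thesis using lt by auto
    qed
    have neg: "(\<Sum>j\<in>{j\<in>R. b \<le> a $ j}. a $ j * x $ j) < b" if ab: "(a, b) \<in> I" "b < 0" for a b
    proof -
      \<comment> \<open>On \<open>R - F\<close> all coefficients are below \<open>b < 0\<close>. A
        nonzero integer point supported there has an entry at least 1, which alone pushes
        \<open>a \<bullet> y\<close> below \<open>b\<close>.\<close>
      define F where "F = {j\<in>R. b \<le> a $ j}"
      have "\<not> (b \<le> a \<bullet> restrict_vec F x)"
      proof (rule keep[OF ab(1)])
        fix y :: "real ^ 'n"
        assume y: "y \<in> int_points" "0 \<le> y" "y \<noteq> 0" "\<forall>j. j \<notin> R - F \<longrightarrow> y $ j = 0"
        have yn: "0 \<le> y $ j" for j using y by (auto simp: less_eq_vec_def)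
        have le: "a $ j * y $ j \<le> 0" for j
        proof (cases "j \<in> R - F")
          case True
          then have "a $ j \<le> 0" using ab by (auto simp: F_def)
          then show ?thesis using yn[of j] by (simp add: mult_nonpos_nonneg)
        qed (use y in auto)
        obtain i where "y $ i \<noteq> 0" using y(3) by (auto simp: vec_eq_iff)
        then have i: "i \<in> R - F" "y $ i > 0" using y(4) yn[of i] by auto
        have "y $ i \<in> \<int>" using y(1) by (auto simp: int_points_def)
        then have "y $ i \<ge> 1" using i(2) by (auto elim!: Ints_cases)
        moreover have "a $ i < b" using i by (auto simp: F_def)
        ultimately have "a $ i * y $ i < b"
          using ab(2) mult_left_mono_neg[of 1 "y $ i" "a $ i"] by linarith
        moreover have "a \<bullet> y = a $ i * y $ i + (\<Sum>j\<in>UNIV - {i}. a $ j * y $ j)"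
          unfolding inner_vec_def by (subst sum.remove[of _ i]) auto
        moreover have "(\<Sum>j\<in>UNIV - {i}. a $ j * y $ j) \<le> 0" using le by (auto intro: sum_nonpos)
        ultimately show "a \<bullet> y < b" by linarith
      qed (auto simp: F_def)
      then show ?thesis by (simp add: inner_restrict_vec F_def)
    qed
    \<comment> \<open>For \<open>b < 0\<close> the weight bounds the cost of the coordinate \<open>j\<close>: \<open>a $ j / b\<close> when scaling onto the
      hyperplane \<open>a \<bullet> y = b\<close>, or \<open>1\<close> when using the unit vector instead. Since weights are at most \<open>1\<close>,
      rounding down loses at most the number of nonzero entries.\<close>
    define g :: "(real ^ 'n) \<times> real \<Rightarrow> 'n \<Rightarrow> real"
      where "g = (\<lambda>(a, b) j. if b < 0 then min 1 (a $ j / b) else max (a $ j) 0)"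
    show ?thesis
    proof (cases "\<exists>a b. (a, b) \<in> I \<and> b < 0 \<and> (\<Sum>j\<in>R. g (a, b) j * x $ j) \<le> real K + 1")
      case True
      then obtain a b where ab: "(a, b) \<in> I" "b < 0"
        and le: "(\<Sum>j\<in>R. g (a, b) j * x $ j) \<le> real K + 1" by blast
      define N where "N = {j\<in>R. b \<le> a $ j}"
      have NR: "N \<subseteq> R" by (auto simp: N_def)
      \<comment> \<open>Dividing the restriction to \<open>N\<close> by \<open>t\<close> puts it
        exactly on the hyperplane \<open>a \<bullet> y = b\<close>, and \<open>t > 1\<close> keeps
        it below \<open>x\<close>. So this part costs \<open>t\<close>, the remaining coordinates
        are paid for by unit vectors, and the total is the weighted sum of \<open>x\<close>.\<close>
      define t where "t = (\<Sum>j\<in>N. a $ j * x $ j) / b"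
      have t: "t > 1" using neg[OF ab] ab(2) by (simp add: t_def N_def field_simps)
      have "(1 / t) *\<^sub>R restrict_vec N x \<in> Z"
      proof (rule out)
        show "(a, b) \<in> H" using ab IH by auto
        show "0 \<le> (1 / t) *\<^sub>R restrict_vec N x" "(1 / t) *\<^sub>R restrict_vec N x \<le> x"
          using t xn mult_right_mono[of "1 / t" 1] by (auto simp: less_eq_vec_def restrict_vec_def)
        have "a \<bullet> ((1 / t) *\<^sub>R restrict_vec N x) = (1 / t) * (\<Sum>j\<in>N. a $ j * x $ j)"
          by (simp add: inner_restrict_vec)
        also have "\<dots> = b" using t ab(2) by (auto simp: t_def field_simps)
        finally show "b \<le> a \<bullet> ((1 / t) *\<^sub>R restrict_vec N x)" by simp
      qed
      then have "t *\<^sub>R ((1 / t) *\<^sub>R restrict_vec N x) \<in> (*\<^sub>R) t ` Z" by (rule imageI)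
      then have "restrict_vec N x \<in> (*\<^sub>R) t ` Z" using t by simp
      then have in_t: "restrict_vec R x \<in> (*\<^sub>R) (t + (\<Sum>j\<in>R - N. x $ j)) ` Z"
        unfolding restrict_vec_Diff[OF NR] using t xn
        by (intro convex_scaling_add[OF Z(1)] restrict_vec_in_simplex_scaling[OF Z x] sum_nonneg) auto
      have t_eq: "t + (\<Sum>j\<in>R - N. x $ j) = (\<Sum>j\<in>R. g (a, b) j * x $ j)"
      proof -
        have "(\<Sum>j\<in>R. g (a, b) j * x $ j) =
          (\<Sum>j\<in>R - N. g (a, b) j * x $ j) + (\<Sum>j\<in>N. g (a, b) j * x $ j)"
          by (intro sum.subset_diff) (auto simp: N_def)
        also have "(\<Sum>j\<in>R - N. g (a, b) j * x $ j) = (\<Sum>j\<in>R - N. x $ j)"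
          using ab(2) by (intro sum.cong) (auto simp: g_def N_def min_def field_simps)
        also have "(\<Sum>j\<in>N. g (a, b) j * x $ j) = (\<Sum>j\<in>N. a $ j * x $ j / b)"
          using ab(2) by (intro sum.cong) (auto simp: g_def N_def min_def field_simps)
        finally show ?thesis by (simp add: t_def sum_divide_distrib)
      qed
      have t_ge: "t + (\<Sum>j\<in>R - N. x $ j) \<ge> 0"
        using t xn by (intro add_nonneg_nonneg sum_nonneg) auto
      show ?thesis
        unfolding K_def[symmetric]
        by (rule convex_scaling_mono[OF Z(1,2) t_ge _ in_t]) (use t_eq le in linarith)
    next
      case False
      then have big: "(\<Sum>j\<in>R. g (a, b) j * x $ j) > real K + 1" if "(a, b) \<in> I" "b < 0" for a b
        using that by force
      \<comment> \<open>A basic solution has the same weighted sums as \<open>x\<close> for all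
        active inequalities but at most \<open>card I\<close> nonzero entries. It is rounded down to
        the integer point \<open>z\<close>.\<close>
      obtain y where y: "\<And>j. j \<in> R \<Longrightarrow> 0 \<le> y j" "card {j\<in>R. y j \<noteq> 0} \<le> card I"
        "\<And>i. i \<in> I \<Longrightarrow> (\<Sum>j\<in>R. g i j * y j) = (\<Sum>j\<in>R. g i j * x $ j)"
        using conic_caratheodory[OF finI, of R "\<lambda>j. x $ j" g] xn by auto
      have cardK: "card {j\<in>R. y j \<noteq> 0} \<le> K"
        using y(2) by (auto simp: K_def intro: card_mono)
      define z :: "real ^ 'n" where "z = (\<chi> j. if j \<in> R then of_int \<lfloor>y j\<rfloor> else 0)"
      have az: "a \<bullet> z = (\<Sum>j\<in>R. a $ j * of_int \<lfloor>y j\<rfloor>)" for a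
        using inner_restrict_vec[of a R "\<chi> j. of_int \<lfloor>y j\<rfloor>"]
        by (simp add: z_def restrict_vec_def if_distrib cong: if_cong)
      \<comment> \<open>Rounding loses at most 1 per nonzero entry, so at most \<open>K\<close> of a
        sum exceeding \<open>K + 1\<close>. More than 1 remains, and multiplying by the negative
        \<open>b\<close> reverses the inequality.\<close>
      have zneg: "a \<bullet> z < b" if ab: "(a, b) \<in> I" "b < 0" for a b
      proof -
        have "(\<Sum>j\<in>R. g (a, b) j * y j) - (\<Sum>j\<in>R. g (a, b) j * of_int \<lfloor>y j\<rfloor>) =
          (\<Sum>j\<in>R. g (a, b) j * (y j - of_int \<lfloor>y j\<rfloor>))"
          by (simp add: sum_subtractf right_diff_distrib)
        also have "\<dots> \<le> (\<Sum>j\<in>R. if y j \<noteq> 0 then 1 else 0)"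
        proof (intro sum_mono)
          fix j
          have d: "0 \<le> y j - of_int \<lfloor>y j\<rfloor>" "y j - of_int \<lfloor>y j\<rfloor> \<le> 1" by linarith+
          have "g (a, b) j \<le> 1" using ab(2) by (simp add: g_def)
          then have "g (a, b) j * (y j - of_int \<lfloor>y j\<rfloor>) \<le> 1"
            by (rule order_trans[OF mult_right_mono[OF _ d(1)]]) (use d(2) in simp)
          then show "g (a, b) j * (y j - of_int \<lfloor>y j\<rfloor>) \<le> (if y j \<noteq> 0 then 1 else 0)"
            by (cases "y j = 0") simp_all
        qed
        also have "\<dots> = real (card {j\<in>R. y j \<noteq> 0})" by (simp flip: sum.inter_filter)
        finally have "(\<Sum>j\<in>R. g (a, b) j * of_int \<lfloor>y j\<rfloor>) > 1"
          using y(3)[OF ab(1)] big[OF ab] cardK by linarith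
        also have "(\<Sum>j\<in>R. g (a, b) j * of_int \<lfloor>y j\<rfloor>) \<le> (\<Sum>j\<in>R. a $ j / b * of_int \<lfloor>y j\<rfloor>)"
          using y(1) ab(2) by (intro sum_mono mult_right_mono) (auto simp: g_def)
        also have "\<dots> = a \<bullet> z / b" by (simp add: az sum_divide_distrib)
        finally show ?thesis using ab(2) by (simp add: field_simps)
      qed
      \<comment> \<open>Here the weights are nonnegative, so rounding down cannot increase the
        sum.\<close>
      have zpos: "a \<bullet> z < b" if ab: "(a, b) \<in> I" "b \<ge> 0" for a b
      proof -
        have "a \<bullet> z \<le> (\<Sum>j\<in>R. max (a $ j) 0 * y j)"
          unfolding az
        proof (intro sum_mono)
          fix j assume "j \<in> R"
          then have "0 \<le> (of_int \<lfloor>y j\<rfloor> :: real)" using y(1) by simp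
          then show "a $ j * of_int \<lfloor>y j\<rfloor> \<le> max (a $ j) 0 * y j"
            by (intro mult_mono) auto
        qed
        also have "\<dots> = (\<Sum>j\<in>R. max (a $ j) 0 * x $ j)"
          using y(3)[OF ab(1)] ab(2) by (simp add: g_def)
        finally show ?thesis using pos[OF ab] by simp
      qed
      \<comment> \<open>A negative \<open>b\<close> would force \<open>z \<noteq> 0\<close>, and
        \<open>z\<close> would be a nonzero integer point satisfying every active inequality
        strictly.\<close>
      have allpos: "b > 0" if "(a, b) \<in> I" for a b
      proof (rule ccontr)
        assume "\<not> b > 0"
        then have "b < 0" using pos[OF that] by force
        then have "z \<noteq> 0" using zneg[OF that] by auto
        moreover have "z \<in> int_points" "0 \<le> z" "\<forall>j. j \<notin> R \<longrightarrow> z $ j = 0"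
          using y(1) by (auto simp: z_def int_points_def less_eq_vec_def)
        ultimately obtain a' b' where "(a', b') \<in> I" "b' \<le> a' \<bullet> z" using viol by blast
        then show False using zneg[of a' b'] zpos[of a' b'] by force
      qed
      have cover: "\<exists>a b. (a, b) \<in> I \<and> b \<le> a $ j" if "j \<in> R" for j
      proof -
        have "axis j 1 \<in> int_points" "0 \<le> (axis j 1 :: real ^ 'n)" "axis j 1 \<noteq> (0 :: real ^ 'n)"
          "\<forall>i. i \<notin> R \<longrightarrow> (axis j 1 :: real ^ 'n) $ i = 0"
          using that by (auto simp: int_points_def axis_def less_eq_vec_def vec_eq_iff)
        from viol[OF this] show ?thesis by (auto simp: inner_axis)
      qed
      \<comment> \<open>With all right-hand sides positive, unit vectors suffice. Each
        \<open>x $ j\<close> is at most 1 and is also charged to an inequality not strictly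
        satisfied by the unit vector; by \<open>pos\<close> every inequality receives a total charge
        below 1. The entries on \<open>R\<close> therefore sum to at most \<open>card R\<close> and
        at most \<open>card I\<close>.\<close>
      have "x $ j \<le> 1 \<and> x $ j \<le> (\<Sum>i\<in>I. max (fst i $ j) 0 * x $ j / snd i)" if j: "j \<in> R" for j
      proof
        obtain a b where ab: "(a, b) \<in> I" "b \<le> a $ j" using cover[OF j] by blast
        have b: "b > 0" using allpos[OF ab(1)] .
        have "max (a $ j) 0 * x $ j \<le> (\<Sum>j\<in>R. max (a $ j) 0 * x $ j)"
          using j xn by (intro member_le_sum) auto
        then have "a $ j * x $ j < b" using pos[OF ab(1)] b ab(2) by (auto simp: max_def)
        then have "b * x $ j < b * 1" using ab(2) xn[of j] mult_right_mono[of b "a $ j" "x $ j"] by auto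
        then show "x $ j \<le> 1" using b by (simp add: field_simps)
        have "b * x $ j \<le> max (a $ j) 0 * x $ j" using ab(2) xn by (intro mult_right_mono) auto
        then have "x $ j \<le> max (fst (a, b) $ j) 0 * x $ j / snd (a, b)"
          using b by (simp add: field_simps)
        also have "\<dots> \<le> (\<Sum>i\<in>I. max (fst i $ j) 0 * x $ j / snd i)"
          using ab(1) finI xn allpos
          by (intro member_le_sum) (auto intro!: divide_nonneg_pos mult_nonneg_nonneg)
        finally show "x $ j \<le> (\<Sum>i\<in>I. max (fst i $ j) 0 * x $ j / snd i)" .
      qed
      note bnd = this
      have "(\<Sum>j\<in>R. x $ j) \<le> (\<Sum>j\<in>R. 1)" using bnd by (intro sum_mono) auto
      moreover have "(\<Sum>j\<in>R. x $ j) \<le> (\<Sum>j\<in>R. \<Sum>i\<in>I. max (fst i $ j) 0 * x $ j / snd i)"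
        using bnd by (intro sum_mono) auto
      moreover have "\<dots> = (\<Sum>i\<in>I. (\<Sum>j\<in>R. max (fst i $ j) 0 * x $ j) / snd i)"
        by (subst sum.swap) (simp add: sum_divide_distrib)
      moreover have "\<dots> \<le> (\<Sum>i\<in>I. 1)"
        using pos allpos by (intro sum_mono) (force simp: field_simps)
      ultimately have le: "(\<Sum>j\<in>R. x $ j) \<le> real K + 1" by (simp add: K_def min_def)
      have ge: "0 \<le> (\<Sum>j\<in>R. x $ j)" using xn by (intro sum_nonneg) auto
      show ?thesis
        unfolding K_def[symmetric]
        by (rule convex_scaling_mono[OF Z(1,2) ge le restrict_vec_in_simplex_scaling[OF Z x]])
    qed
  qed
qed

text \<open>Initially all inequalities are active and no coordinate has been removed, so the
  condition on inactive inequalities is vacuous.\<close>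

lemma lattice_free_scaling:
  fixes Z :: "(real ^ 'n) set"
  assumes "convex Z" "0 \<in> Z" "\<And>j. axis j 1 \<in> Z" "0 \<le> x" "finite H"
    and "\<And>a b y. (a, b) \<in> H \<Longrightarrow> 0 \<le> y \<Longrightarrow> y \<le> x \<Longrightarrow> b \<le> a \<bullet> y \<Longrightarrow> y \<in> Z"
    and "\<And>y. y \<in> int_points \<Longrightarrow> \<exists>(a, b)\<in>H. b \<le> a \<bullet> y"
    and "card H \<le> k"
  shows "(1 / (real (min k CARD('n)) + 1)) *\<^sub>R x \<in> Z"
proof -
  have "restrict_vec UNIV x \<in> (*\<^sub>R) (real (min (card H) CARD('n)) + 1) ` Z"
    by (rule lattice_free_scaling_restrict[where H = H]) (use assms in auto)
  then have "restrict_vec UNIV x \<in> (*\<^sub>R) (real (min k CARD('n)) + 1) ` Z"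
    using assms(8) by (elim convex_scaling_mono[OF assms(1,2), rotated 2]) (auto simp: min_def)
  moreover have "restrict_vec UNIV x = x" by (simp add: restrict_vec_def vec_eq_iff)
  ultimately obtain w where w: "w \<in> Z" "x = (real (min k CARD('n)) + 1) *\<^sub>R w" by auto
  have "real (min k CARD('n)) + 1 > 0" by simp
  then show ?thesis using w by simp
qed

section \<open>Loss of a single closure step\<close>

lemma packing_set_downward: "packing_set P \<Longrightarrow> x \<in> P \<Longrightarrow> 0 \<le> y \<Longrightarrow> y \<le> x \<Longrightarrow> y \<in> P"
  unfolding packing_set_def by blast

lemma packing_set_zero:
  fixes P :: "(real ^ 'n) set"
  assumes "packing_set P" "well_behaved P" shows "0 \<in> P"
proof -
  have "(axis undefined 1 :: real ^ 'n) \<in> P" "0 \<le> (axis undefined 1 :: real ^ 'n)"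
    using assms(2) by (simp_all add: well_behaved_def axis_def less_eq_vec_def)
  then show ?thesis using packing_set_downward[OF assms(1)] by blast
qed

lemma int_points_zero: "0 \<in> int_points"
  and int_points_axis: "axis j 1 \<in> int_points"
  by (auto simp: int_points_def axis_def)

text \<open>The origin and the unit vectors are integer points of \<open>P\<close>, so removing a
  lattice-free set leaves them in place.\<close>

lemma hull_diff_lattice_free:
  fixes P :: "(real ^ 'n) set"
  assumes "packing_set P" "well_behaved P" "C \<inter> int_points = {}"
  shows "0 \<in> convex hull (P - C)" "axis j 1 \<in> convex hull (P - C)"
proof -
  have "0 \<in> P - C" using packing_set_zero[OF assms(1,2)] int_points_zero assms(3) by blast
  then show "0 \<in> convex hull (P - C)" by (rule hull_inc)
  have "axis j 1 \<in> P - C"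
    using assms(2,3) int_points_axis[of j] unfolding well_behaved_def by blast
  then show "axis j 1 \<in> convex hull (P - C)" by (rule hull_inc)
qed

lemma lattice_free_polyhedron_scaling:
  fixes P :: "(real ^ 'n) set"
  assumes P: "packing_set P" "well_behaved P" "x \<in> P" and L: "lattice_free_polyhedron k L"
  shows "(1 / (real (min k CARD('n)) + 1)) *\<^sub>R x \<in> convex hull (P - interior L)"
proof -
  obtain H :: "((real ^ 'n) \<times> real) set" where H: "finite H" "card H \<le> k"
    "L = {x. \<forall>(a, b)\<in>H. a \<bullet> x \<le> b}"
    and dim: "aff_dim L = int CARD('n)" and free: "interior L \<inter> int_points = {}"
    using L unfolding lattice_free_polyhedron_def by blast
  have "L \<noteq> {}" using dim by auto
  \<comment> \<open>Inequalities with zero normal hold everywhere, because \<open>L\<close> is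
    nonempty. Without them the interior of \<open>L\<close> is given by the strict
    inequalities.\<close>
  define H' where "H' = {(a, b) \<in> H. a \<noteq> 0}"
  have H': "finite H'" "H' \<subseteq> H" using H(1) by (auto simp: H'_def intro: rev_finite_subset)
  have "card H' \<le> k" using H H' card_mono le_trans by blast
  have L_eq: "L = {x. \<forall>(a, b)\<in>H'. a \<bullet> x \<le> b}"
  proof -
    obtain x0 where "x0 \<in> L" using \<open>L \<noteq> {}\<close> by blast
    have "a \<bullet> y \<le> b" if "\<forall>(a, b)\<in>H'. a \<bullet> y \<le> b" and ab: "(a, b) \<in> H" for a b y
    proof (cases "a = 0")
      case True
      then show ?thesis using \<open>x0 \<in> L\<close> ab unfolding H(3) by auto
    next
      case False
      then have "(a, b) \<in> H'" using ab by (simp add: H'_def)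
      then show ?thesis using that(1) by blast
    qed
    then show ?thesis unfolding H(3) using H'(2) by blast
  qed
  have "open (\<Inter>(a, b)\<in>H'. {x. a \<bullet> x < b})"
    using H'(1) by (intro open_INT) (auto simp: open_halfspace_lt)
  moreover have "(\<Inter>(a, b)\<in>H'. {x. a \<bullet> x < b}) \<subseteq> L"
    unfolding L_eq by (intro subsetI CollectI ballI) (auto intro: less_imp_le)
  ultimately have sub: "(\<Inter>(a, b)\<in>H'. {x. a \<bullet> x < b}) \<subseteq> interior L" by (rule interior_maximal[rotated])
  have sup: "a \<bullet> y < b" if "(a, b) \<in> H'" "y \<in> interior L" for a b y
  proof -
    have "interior L \<subseteq> interior {x. a \<bullet> x \<le> b}"
      using that(1) by (intro interior_mono) (auto simp: L_eq)
    also have "\<dots> = {x. a \<bullet> x < b}" using that(1) by (intro interior_halfspace_le) (auto simp: H'_def)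
    finally show ?thesis using that(2) by auto
  qed
  show ?thesis
  proof (rule lattice_free_scaling[where H = H'])
    show "0 \<le> x" using P(1,3) by (simp add: packing_set_def)
    show "y \<in> convex hull (P - interior L)" if "(a, b) \<in> H'" "0 \<le> y" "y \<le> x" "b \<le> a \<bullet> y" for a b y
    proof (rule hull_inc)
      show "y \<in> P - interior L"
        using packing_set_downward[OF P(1,3) that(2,3)] sup[OF that(1), of y] that(4) by auto
    qed
    show "\<exists>(a, b)\<in>H'. b \<le> a \<bullet> y" if "y \<in> int_points" for y
    proof (rule ccontr)
      assume "\<not> (\<exists>(a, b)\<in>H'. b \<le> a \<bullet> y)"
      then have "y \<in> (\<Inter>(a, b)\<in>H'. {x. a \<bullet> x < b})" by (auto simp: not_le)
      then show False using sub free that by auto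
    qed
  qed (use hull_diff_lattice_free[OF P(1,2) free] H' \<open>card H' \<le> k\<close> in \<open>auto simp: convex_convex_hull\<close>)
qed

section \<open>Splits and unions of splits\<close>

abbreviation real_vec :: "int ^ 'n \<Rightarrow> real ^ 'n" where
  "real_vec p \<equiv> (\<chi> j. of_int (p $ j))"

lemma inner_real_vec_int:
  assumes "y \<in> int_points" shows "real_vec p \<bullet> y \<in> \<int>"
  using assms unfolding inner_vec_def int_points_def by (auto intro!: Ints_sum Ints_mult)

lemma split_set_compl:
  "y \<notin> split_set p p0 \<longleftrightarrow> real_vec p \<bullet> y \<le> of_int p0 \<or> of_int p0 + 1 \<le> real_vec p \<bullet> y"
  by (auto simp: split_set_def)

lemma split_set_int_points: "split_set p p0 \<inter> int_points = {}"
proof -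
  have "y \<notin> split_set p p0" if y: "y \<in> int_points" for y
  proof -
    obtain m where "real_vec p \<bullet> y = of_int m" by (rule Ints_cases[OF inner_real_vec_int[OF y]])
    then show ?thesis unfolding split_set_compl by (cases "m \<le> p0") simp_all
  qed
  then show ?thesis by auto
qed

lemma open_split_set: "open (split_set p p0)"
proof -
  have "split_set p p0 = {x. real_vec p \<bullet> x > of_int p0} \<inter> {x. real_vec p \<bullet> x < of_int p0 + 1}"
    by (auto simp: split_set_def)
  then show ?thesis by (auto intro: open_halfspace_gt open_halfspace_lt)
qed

lemma branch_split_scaling:
  fixes P :: "(real ^ 'n) set"
  assumes P: "packing_set P" "well_behaved P" "x \<in> P"
    and C_def: "C = (\<Union>i\<in>{1..k}. split_set (p i) (p0 i))"
  shows "(1 / (real (min (2 ^ k) CARD('n)) + 1)) *\<^sub>R x \<in> convex hull (P - C)"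
proof (rule ccontr)
  define s where "s = 1 / (real (min (2 ^ k) CARD('n)) + 1)"
  assume neg: "(1 / (real (min (2 ^ k) CARD('n)) + 1)) *\<^sub>R x \<notin> convex hull (P - C)"
  have s: "0 < s" "s \<le> 1" by (auto simp: s_def)
  have free: "C \<inter> int_points = {}" unfolding C_def using split_set_int_points by fast
  have x: "0 \<le> x" using P(1,3) by (simp add: packing_set_def)
  define B where "B = {y. 0 \<le> y \<and> y \<le> x}"
  have B_eq: "B = cbox 0 x"
    by (auto simp: B_def mem_box_cart less_eq_vec_def)
  have "compact B" "convex B" unfolding B_eq by (auto intro: compact_cbox convex_box)
  \<comment> \<open>The hull of \<open>P - C\<close> need not be closed. Its compact subset
    \<open>D\<close> allows strict separation and still contains what the argument uses: the box
    below \<open>x\<close> outside \<open>C\<close>, the origin and the unit vectors.\<close>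
  define D where "D = convex hull ((B - C) \<union> ({0} \<union> range (\<lambda>j. axis j 1)))"
  have "open C" unfolding C_def by (auto intro: open_split_set)
  have "compact (B - C)" using \<open>compact B\<close> \<open>open C\<close> by (rule compact_diff)
  moreover have "compact ({0 :: real ^ 'n} \<union> range (\<lambda>j. axis j 1))"
    by (intro finite_imp_compact) simp
  ultimately have "compact D" unfolding D_def by (metis compact_convex_hull compact_Un)
  have "D \<subseteq> convex hull (P - C)" unfolding D_def
  proof (rule hull_minimal)
    have "B - C \<subseteq> P - C" using packing_set_downward[OF P(1,3)] by (auto simp: B_def)
    then show "(B - C) \<union> ({0} \<union> range (\<lambda>j. axis j 1)) \<subseteq> convex hull (P - C)"
      using hull_diff_lattice_free[OF P(1,2) free] hull_subset[of "P - C" convex] by blast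
  qed (simp add: convex_convex_hull)
  then have "s *\<^sub>R x \<notin> D" using neg by (auto simp: s_def)
  moreover have "convex D" "closed D" using \<open>compact D\<close> by (auto simp: D_def convex_convex_hull compact_imp_closed)
  ultimately obtain c \<beta> where c: "c \<bullet> (s *\<^sub>R x) < \<beta>" "\<And>y. y \<in> D \<Longrightarrow> \<beta> < c \<bullet> y"
    using separating_hyperplane_closed_point[of D "s *\<^sub>R x"] by blast
  define W where "W = B \<inter> {y. c \<bullet> y \<le> \<beta>}"
  have sx: "s *\<^sub>R x \<in> B"
    using s x mult_right_mono[of s 1] by (auto simp: B_def less_eq_vec_def)
  then have W: "convex W" "compact W" "W \<noteq> {}" using \<open>compact B\<close> \<open>convex B\<close> c(1)
    by (auto simp: W_def intro!: convex_Int convex_halfspace_le compact_Int_closed closed_halfspace_le)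
  \<comment> \<open>The cells of the complement of \<open>C\<close>: the set \<open>A\<close>
    records for which splits the lower side is taken.\<close>
  define T where "T = (\<lambda>A. \<Inter>i\<in>{1..k}. if i \<in> A then {y. real_vec (p i) \<bullet> y \<le> of_int (p0 i)}
    else {y. real_vec (p i) \<bullet> y \<ge> of_int (p0 i) + 1})"
  have T: "convex (T A)" "closed (T A)" for A
    unfolding T_def
    by (intro convex_INT closed_INT ballI,
        simp add: convex_halfspace_le convex_halfspace_ge closed_halfspace_le closed_halfspace_ge)+
  have T_C: "y \<notin> C" if y: "y \<in> T A" for y A
  proof -
    have "y \<notin> split_set (p i) (p0 i)" if i: "i \<in> {1..k}" for i
      using INT_D[OF y[unfolded T_def] i] unfolding split_set_compl by (simp split: if_splits)
    then show ?thesis unfolding C_def by blast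
  qed
  have "W \<inter> T A = {}" for A
  proof -
    have "y \<in> D" if "y \<in> B" "y \<in> T A" for y
      unfolding D_def using that T_C by (intro hull_inc) blast
    then show ?thesis using c(2) unfolding W_def by fastforce
  qed
  then have "\<exists>h. (\<forall>y\<in>W. fst h \<bullet> y < snd h) \<and> (\<forall>y\<in>T A. snd h < fst h \<bullet> y)" for A
    using separating_hyperplane_compact_closed[OF W T[of A]] by fastforce
  then obtain h where h: "\<And>A y. y \<in> W \<Longrightarrow> fst (h A) \<bullet> y < snd (h A)"
    "\<And>A y. y \<in> T A \<Longrightarrow> snd (h A) < fst (h A) \<bullet> y" by metis
  \<comment> \<open>The scaling lemma is applied to an open half-space in place of the hull. A box
    point not strictly satisfying some separator lies outside \<open>W\<close>, hence in the
    half-space; an integer point lies in some cell, beyond the separator of that cell.\<close>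
  have "(1 / (real (min (2 ^ k) CARD('n)) + 1)) *\<^sub>R x \<in> {y. \<beta> < c \<bullet> y}"
  proof (rule lattice_free_scaling[where H = "h ` Pow {1..k}"])
    show "convex {y. \<beta> < c \<bullet> y}" by (rule convex_halfspace_gt)
    show "0 \<in> {y. \<beta> < c \<bullet> y}" "axis j 1 \<in> {y. \<beta> < c \<bullet> y}" for j
      using c(2) unfolding D_def by (blast intro: hull_inc)+
    show "y \<in> {y. \<beta> < c \<bullet> y}" if ab: "(a, b) \<in> h ` Pow {1..k}" and "0 \<le> y" "y \<le> x" "b \<le> a \<bullet> y" for a b y
    proof -
      obtain A where "(a, b) = h A" using ab by blast
      then have "y \<notin> W" using that(4) h(1)[of y A] by (metis fst_conv snd_conv not_le)
      then show ?thesis using that(2,3) by (auto simp: W_def B_def)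
    qed
    show "\<exists>(a, b)\<in>h ` Pow {1..k}. b \<le> a \<bullet> y" if "y \<in> int_points" for y
    proof -
      define A where "A = {i\<in>{1..k}. real_vec (p i) \<bullet> y \<le> of_int (p0 i)}"
      have "y \<notin> C" using free that by auto
      then have "of_int (p0 i) + 1 \<le> real_vec (p i) \<bullet> y" if "i \<in> {1..k}" "i \<notin> A" for i
        using that split_set_compl[of y "p i" "p0 i"] unfolding C_def A_def by blast
      then have "y \<in> T A" unfolding T_def by (intro INT_I) (simp add: A_def)
      then have "snd (h A) \<le> fst (h A) \<bullet> y" using h(2) by (simp add: less_imp_le)
      moreover have "h A \<in> h ` Pow {1..k}" by (auto simp: A_def)
      ultimately show ?thesis by (intro bexI[of _ "h A"]) (simp_all add: case_prod_beta)
    qed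
    show "card (h ` Pow {1..k}) \<le> 2 ^ k"
      using card_image_le[of "Pow {1..k}" h] by (simp add: card_Pow)
    show "finite (h ` Pow {1..k})" by (intro finite_imageI) simp
  qed (rule x)
  then show False using c(1) unfolding s_def mem_Collect_eq by (rule less_asym)
qed

text \<open>The bound for unions of splits would only give the factor \<open>min 2 n + 1\<close>.
  For \<open>p0 \<ge> 1\<close> the point \<open>x / 2\<close> itself lies below the split; for
  \<open>p0 = 0\<close> it is the midpoint of two restrictions of \<open>x\<close>, by the sign of
  the coefficients.\<close>

lemma half_in_hull_split_nonneg:
  fixes P :: "(real ^ 'n) set"
  assumes P: "packing_set P" "well_behaved P" "x \<in> P" and "0 \<le> p0"
  shows "(1 / 2) *\<^sub>R x \<in> convex hull (P - split_set p p0)"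
proof -
  define Z where "Z = convex hull (P - split_set p p0)"
  have cvx: "convex Z" by (simp add: Z_def convex_convex_hull)
  note Z = hull_diff_lattice_free[OF P(1,2) split_set_int_points[of p p0], folded Z_def]
  have x: "0 \<le> x" using P(1,3) by (simp add: packing_set_def)
  have half: "(1 / 2) *\<^sub>R u + (1 / 2) *\<^sub>R v \<in> Z" if "u \<in> Z" "v \<in> Z" for u v
    by (rule convexD[OF cvx that]) simp_all
  have inZ: "y \<in> Z" if "0 \<le> y" "y \<le> x" "y \<notin> split_set p p0" for y
    unfolding Z_def using that packing_set_downward[OF P(1,3)] by (intro hull_inc) blast
  define \<pi> where "\<pi> = real_vec p"
  have \<pi>_nth: "\<pi> $ j = of_int (p $ j)" for j by (simp add: \<pi>_def)
  note compl = split_set_compl[of _ p p0, folded \<pi>_def]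
  have "(1 / 2) *\<^sub>R x \<in> Z"
  proof (cases "x \<in> split_set p p0")
    case False
    then show ?thesis using half[OF inZ[OF x order_refl] Z(1)] by simp
  next
    case True
    then have px: "\<pi> \<bullet> x < of_int p0 + 1" using compl[of x] by linarith
    show ?thesis
    proof (cases "p0 = 0")
      case False
      then have "real_of_int p0 \<ge> 1" using assms(4) by linarith
      then have "\<pi> \<bullet> ((1 / 2) *\<^sub>R x) \<le> of_int p0" using px by simp
      moreover have "0 \<le> (1 / 2) *\<^sub>R x" "(1 / 2) *\<^sub>R x \<le> x"
        using x by (simp_all add: less_eq_vec_def)
      ultimately show ?thesis using compl by (intro inZ) blast+
    next
      case True
      define A where "A = {j. p $ j \<ge> 1}"
      have xn: "0 \<le> x $ j" for j using x by (simp add: less_eq_vec_def)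
      have "\<pi> \<bullet> restrict_vec (- A) x \<le> 0"
        unfolding inner_restrict_vec \<pi>_nth
        using xn by (intro sum_nonpos mult_nonpos_nonneg) (auto simp: A_def)
      then have "restrict_vec (- A) x \<notin> split_set p p0"
        using compl[of "restrict_vec (- A) x"] True by simp
      then have neg: "restrict_vec (- A) x \<in> Z" by (intro inZ restrict_vec_bounds[OF x])
      have pos: "restrict_vec A x \<in> Z"
      proof (cases "\<pi> \<bullet> restrict_vec A x \<ge> 1")
        case ge: True
        then have "restrict_vec A x \<notin> split_set p p0"
          using compl[of "restrict_vec A x"] True by simp
        then show ?thesis by (intro inZ restrict_vec_bounds[OF x])
      next
        case False
        \<comment> \<open>Positive integer coefficients are at least 1, so a value below 1 bounds
          the sum of the entries and the restriction lies in the simplex of \<open>0\<close> and the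
          unit vectors.\<close>
        have "(\<Sum>j\<in>A. x $ j) \<le> (\<Sum>j\<in>A. \<pi> $ j * x $ j)"
        proof (intro sum_mono)
          fix j assume "j \<in> A"
          then have "1 * x $ j \<le> \<pi> $ j * x $ j"
            using xn by (intro mult_right_mono) (auto simp: A_def \<pi>_nth)
          then show "x $ j \<le> \<pi> $ j * x $ j" by simp
        qed
        then have le: "(\<Sum>j\<in>A. x $ j) \<le> 1" using False unfolding inner_restrict_vec by linarith
        have ge: "0 \<le> (\<Sum>j\<in>A. x $ j)" using xn by (intro sum_nonneg) auto
        have "restrict_vec A x \<in> (*\<^sub>R) 1 ` Z"
          by (rule convex_scaling_mono[OF cvx Z(1) ge le
              restrict_vec_in_simplex_scaling[OF cvx Z x]])
        then show ?thesis by auto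
      qed
      have "x = restrict_vec A x + restrict_vec (- A) x"
        by (simp add: restrict_vec_def vec_eq_iff)
      then have "(1 / 2) *\<^sub>R x = (1 / 2) *\<^sub>R restrict_vec A x + (1 / 2) *\<^sub>R restrict_vec (- A) x"
        by (metis scaleR_add_right)
      then show ?thesis using half[OF pos neg] by (simp only:)
    qed
  qed
  then show ?thesis by (simp add: Z_def)
qed

text \<open>Reversing the normal describes the same strip and exchanges negative and nonnegative
  \<open>p0\<close>.\<close>

lemma split_set_uminus: "split_set (- p) (- p0 - 1) = split_set p p0"
proof -
  have "real_vec (- p) = - real_vec p" by (simp add: vec_eq_iff)
  then have inner: "real_vec (- p) \<bullet> x = - (real_vec p \<bullet> x)" for x by (metis inner_minus_left)
  have "of_int (- p0 - 1) < - u \<and> - u < of_int (- p0 - 1) + 1 \<longleftrightarrow>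
    of_int p0 < u \<and> u < of_int p0 + 1" for u :: real by auto
  then show ?thesis unfolding split_set_def inner by (simp only:)
qed

lemma split_scaling:
  fixes P :: "(real ^ 'n) set"
  assumes "packing_set P" "well_behaved P" "x \<in> P"
  shows "(1 / 2) *\<^sub>R x \<in> convex hull (P - split_set p p0)"
proof (cases "0 \<le> p0")
  case False
  then show ?thesis
    using half_in_hull_split_nonneg[OF assms, of "- p0 - 1" "- p"]
    unfolding split_set_uminus by simp
qed (rule half_in_hull_split_nonneg[OF assms])

section \<open>Iterated closures and rank\<close>

lemma iterated_closure_scaling:
  fixes Q :: "(real ^ 'n) set" and M :: "(real ^ 'n) set \<Rightarrow> (real ^ 'n) set"
  assumes Q: "packing_set Q" "well_behaved Q" "x \<in> Q" and "\<alpha> > 0"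
    and M: "\<And>P. M P = (\<Inter>C\<in>\<C>. convex hull (P - C))"
    and free: "\<And>C. C \<in> \<C> \<Longrightarrow> C \<inter> int_points = {}"
    and scaling: "\<And>P C z. packing_set P \<Longrightarrow> well_behaved P \<Longrightarrow> z \<in> P \<Longrightarrow> C \<in> \<C> \<Longrightarrow>
       (1 / \<alpha>) *\<^sub>R z \<in> convex hull (P - C)"
  shows "(1 / \<alpha> ^ m) *\<^sub>R x \<in> (M ^^ m) Q"
proof -
  \<comment> \<open>Scaling \<open>Q\<close> down may lose unit vectors; the added boxes keep every
    \<open>P s\<close> well-behaved and a packing set.\<close>
  define P where "P = (\<lambda>s. {z. 0 \<le> z \<and> s *\<^sub>R z \<in> Q} \<union> {z. 0 \<le> z \<and> (\<exists>j. z \<le> axis j 1)})"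
  have mono: "M A \<subseteq> M B" if "A \<subseteq> B" for A B
    unfolding M using that by (intro INF_superset_mono hull_mono) auto
  have packing: "packing_set (P s)" if "s > 0" for s
    unfolding packing_set_def
  proof (intro conjI ballI allI impI)
    fix z y assume zy: "z \<in> P s" "0 \<le> y \<and> y \<le> z"
    then have "s *\<^sub>R y \<in> Q" if "s *\<^sub>R z \<in> Q"
      using zy(2) \<open>s > 0\<close> by (intro packing_set_downward[OF Q(1) that]) (simp_all add: less_eq_vec_def)
    moreover have "y \<le> w" if "z \<le> w" for w using zy(2) that by (blast intro: order_trans)
    ultimately show "y \<in> P s" using zy unfolding P_def by blast
  qed (auto simp: P_def)
  have axis: "0 \<le> (axis j 1 :: real ^ 'n)" for j by (auto simp: axis_def less_eq_vec_def)
  have wb: "well_behaved (P s)" for s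
    unfolding well_behaved_def P_def using axis by blast
  \<comment> \<open>The scaled copy of \<open>Q\<close> loses the factor \<alpha>, while the boxes
    lose nothing: their points lie on segments from \<open>0\<close> to a unit vector.\<close>
  have step: "P (\<alpha> * s) \<subseteq> M (P s)" if "s > 0" for s
  proof
    fix z assume z: "z \<in> P (\<alpha> * s)"
    show "z \<in> M (P s)"
      unfolding M
    proof
      fix C assume C: "C \<in> \<C>"
      show "z \<in> convex hull (P s - C)"
      proof (cases "(\<alpha> * s) *\<^sub>R z \<in> Q")
        case True
        moreover have "0 \<le> z" using z by (auto simp: P_def)
        then have "0 \<le> \<alpha> *\<^sub>R z" using \<open>\<alpha> > 0\<close> by (simp add: less_eq_vec_def)
        ultimately have "\<alpha> *\<^sub>R z \<in> P s" by (simp add: P_def mult.commute)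
        from scaling[OF packing[OF that] wb this C] show ?thesis using \<open>\<alpha> > 0\<close> by simp
      next
        case False
        then obtain j where j: "0 \<le> z" "z \<le> axis j 1" using z by (auto simp: P_def)
        have zb: "0 \<le> z $ i" "z $ i \<le> axis j 1 $ i" for i
          using j by (simp_all add: less_eq_vec_def)
        have zi: "z $ i = 0" if "i \<noteq> j" for i using zb[of i] that by (simp add: axis_def)
        have zj: "0 \<le> z $ j" "z $ j \<le> 1" using zb[of j] by simp_all
        note hull = hull_diff_lattice_free[OF packing[OF that] wb free[OF C]]
        have "(1 - z $ j) *\<^sub>R 0 + (z $ j) *\<^sub>R axis j 1 \<in> convex hull (P s - C)"
          by (rule convexD[OF convex_convex_hull hull]) (use zj in simp_all)
        also have "(1 - z $ j) *\<^sub>R 0 + (z $ j) *\<^sub>R axis j 1 = z"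
          using zi by (auto simp: vec_eq_iff axis_def)
        finally show ?thesis .
      qed
    qed
  qed
  have "P (\<alpha> ^ m) \<subseteq> (M ^^ m) Q"
  proof (induction m)
    case 0
    have "z \<in> Q" if "0 \<le> z" "z \<le> axis j 1" for z j
      using packing_set_downward[OF Q(1) _ that] Q(2) by (simp add: well_behaved_def)
    then show ?case by (auto simp: P_def)
  next
    case (Suc m)
    have "P (\<alpha> ^ Suc m) \<subseteq> M (P (\<alpha> ^ m))" using step[of "\<alpha> ^ m"] \<open>\<alpha> > 0\<close> by simp
    also have "\<dots> \<subseteq> (M ^^ Suc m) Q" using mono[OF Suc] by simp
    finally show ?case .
  qed
  moreover have "0 \<le> x" using Q(1,3) by (simp add: packing_set_def)
  then have "(1 / \<alpha> ^ m) *\<^sub>R x \<in> P (\<alpha> ^ m)"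
    using Q(3) \<open>\<alpha> > 0\<close> by (simp add: P_def less_eq_vec_def)
  ultimately show ?thesis by blast
qed

section \<open>From scaling to optimal values and rank\<close>

lemma max_value_scaling:
  assumes "s > 0" "\<And>x. x \<in> A \<Longrightarrow> (1 / s) *\<^sub>R x \<in> B"
  shows "max_value A c \<le> ereal s * max_value B c"
  unfolding max_value_def
proof (rule SUP_least)
  fix x assume "x \<in> A"
  then have "ereal (c \<bullet> ((1 / s) *\<^sub>R x)) \<le> (SUP x\<in>B. ereal (c \<bullet> x))"
    by (intro SUP_upper assms(2) \<open>x \<in> A\<close>)
  then have "ereal s * ereal (c \<bullet> ((1 / s) *\<^sub>R x)) \<le> ereal s * (SUP x\<in>B. ereal (c \<bullet> x))"
    using assms(1) by (intro ereal_mult_left_mono) auto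
  then show "ereal (c \<bullet> x) \<le> ereal s * (SUP x\<in>B. ereal (c \<bullet> x))" using assms(1) by simp
qed

text \<open>The ceiling costs nothing because \<open>m\<close> is an integer. In the degenerate
  cases \<open>u = 0\<close>, \<open>v = 0\<close> or \<open>v = \<infinity>\<close> the quotient is
  0, whose logarithm is \<open>- \<infinity>\<close>.\<close>

lemma ceiling_log_ratio_le:
  assumes "0 \<le> u" "0 \<le> v" "u \<le> ereal (\<alpha> ^ m) * v" "\<alpha> > 1"
  shows "ceiling_ereal (log2_ereal (u / v) / ereal (log 2 \<alpha>)) \<le> ereal (real m)"
proof -
  have la: "log 2 \<alpha> > 0" using assms by simp
  have zero: "ceiling_ereal (log2_ereal 0 / ereal (log 2 \<alpha>)) \<le> ereal (real m)"
    using la by (simp add: zero_ereal_def log2_ereal_def ceiling_ereal_def divide_ereal_def)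
  show ?thesis
  proof (cases v)
    case (real r)
    have "u \<le> ereal (\<alpha> ^ m * r)" using assms(3) real by simp
    then obtain q where q: "u = ereal q" using assms(1) by (cases u) auto
    have qr: "0 \<le> q" "0 \<le> r" "q \<le> \<alpha> ^ m * r" using assms q real by auto
    show ?thesis
    proof (cases "q / r > 0")
      case False
      then have "q = 0 \<or> r = 0" using qr by (auto simp: zero_less_divide_iff)
      then have "u = 0" using qr q by auto
      then show ?thesis using zero by simp
    next
      case True
      then have r: "r > 0" "q > 0" using qr by (auto simp: zero_less_divide_iff)
      then have "log 2 (q / r) \<le> log 2 (\<alpha> ^ m)"
        using qr assms(4) by (intro log_mono) (auto simp: field_simps)
      also have "\<dots> = real m * log 2 \<alpha>" using assms(4) by (simp add: log_nat_power)
      finally have "log 2 (q / r) / log 2 \<alpha> \<le> real m" using la by (simp add: field_simps)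
      then have "\<lceil>log 2 (q / r) / log 2 \<alpha>\<rceil> \<le> int m" by (simp add: ceiling_le_iff)
      then have "real_of_int \<lceil>log 2 (q / r) / log 2 \<alpha>\<rceil> \<le> real m" by linarith
      moreover have "u / v = ereal (q / r)" using q real r by simp
      ultimately show ?thesis
        using True la by (simp add: log2_ereal_def ceiling_ereal_def)
    qed
  qed (use assms zero in auto)
qed

lemma closure_rank_lower_bound:
  fixes Q :: "(real ^ 'n) set" and M :: "(real ^ 'n) set \<Rightarrow> (real ^ 'n) set"
  assumes Q: "packing_set Q" "well_behaved Q" and "\<alpha> > 1"
    and M: "\<And>P. M P = (\<Inter>C\<in>\<C>. convex hull (P - C))"
    and free: "\<And>C. C \<in> \<C> \<Longrightarrow> C \<inter> int_points = {}"
    and scaling: "\<And>P C z. packing_set P \<Longrightarrow> well_behaved P \<Longrightarrow> z \<in> P \<Longrightarrow> C \<in> \<C> \<Longrightarrow>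
       (1 / \<alpha>) *\<^sub>R z \<in> convex hull (P - C)"
  shows "(SUP c\<in>{c. 0 \<le> c}. ceiling_ereal (log2_ereal (zLP Q c / zI Q c) / ereal (log 2 \<alpha>)))
    \<le> ereal_of_enat (closure_rank M Q)"
proof (cases "{m. (M ^^ m) Q = int_hull Q} = {}")
  case True
  then have "closure_rank M Q = \<infinity>" by (simp add: closure_rank_def top_enat_def)
  then show ?thesis by simp
next
  case False
  then obtain m0 where "m0 \<in> {m. (M ^^ m) Q = int_hull Q}" by blast
  \<comment> \<open>An infimum of a nonempty set of naturals is attained, so the rank is an actual
    number of iterations reaching the integer hull.\<close>
  then have "closure_rank M Q \<in> enat ` {m. (M ^^ m) Q = int_hull Q}"
    using False unfolding closure_rank_def Inf_enat_def
    by (simp only: image_is_empty if_False) (rule LeastI, erule imageI)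
  then obtain m where m: "closure_rank M Q = enat m" "(M ^^ m) Q = int_hull Q" by auto
  have "0 \<in> Q" using packing_set_zero[OF Q] .
  then have "0 \<in> int_hull Q" unfolding int_hull_def using int_points_zero by (auto intro: hull_inc)
  have "ceiling_ereal (log2_ereal (zLP Q c / zI Q c) / ereal (log 2 \<alpha>)) \<le> ereal (real m)" for c
  proof (rule ceiling_log_ratio_le[OF _ _ _ \<open>\<alpha> > 1\<close>])
    show "0 \<le> zLP Q c" "0 \<le> zI Q c"
      unfolding zLP_def zI_def max_value_def using \<open>0 \<in> Q\<close> \<open>0 \<in> int_hull Q\<close>
      by (auto intro!: SUP_upper2[of 0])
    show "zLP Q c \<le> ereal (\<alpha> ^ m) * zI Q c"
      unfolding zLP_def zI_def
    proof (rule max_value_scaling)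
      fix x assume "x \<in> Q"
      have "\<alpha> > 0" using \<open>\<alpha> > 1\<close> by simp
      show "(1 / \<alpha> ^ m) *\<^sub>R x \<in> int_hull Q"
        using iterated_closure_scaling[OF Q \<open>x \<in> Q\<close> \<open>\<alpha> > 0\<close> M free scaling, where m = m]
        by (simp add: m)
    qed (use \<open>\<alpha> > 1\<close> in simp)
  qed
  then show ?thesis by (auto simp: m intro: SUP_least)
qed

theorem corollary1:
  fixes Q :: "(real ^ 'n) set"
  assumes "packing_set Q" and "well_behaved Q"
  shows "(ereal_of_enat (closure_rank split_closure Q) \<ge>
            (SUP c\<in>{c. 0 \<le> c}. ceiling_ereal (log2_ereal (zLP Q c / zI Q c)))) \<and>
         (\<forall>k::nat. k \<ge> 1 \<longrightarrow>
            ereal_of_enat (closure_rank (branch_split_closure k) Q) \<ge>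
            (SUP c\<in>{c. 0 \<le> c}.
               ceiling_ereal (log2_ereal (zLP Q c / zI Q c) /
                              ereal (log 2 (real (min (2 ^ k) CARD('n)) + 1))))) \<and>
         (\<forall>k::nat. k \<ge> 2 \<longrightarrow>
            ereal_of_enat (closure_rank (lattice_free_closure k) Q) \<ge>
            (SUP c\<in>{c. 0 \<le> c}.
               ceiling_ereal (log2_ereal (zLP Q c / zI Q c) /
                              ereal (log 2 (real (min k CARD('n)) + 1)))))"
proof (intro conjI allI impI)
  \<comment> \<open>The divisor \<open>log 2 2 = 1\<close> brings the claim into the general form
    with factor 2.\<close>
  have "(SUP c\<in>{c. 0 \<le> c}. ceiling_ereal (log2_ereal (zLP Q c / zI Q c) / ereal (log 2 2)))
    \<le> ereal_of_enat (closure_rank split_closure Q)"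
  proof (rule closure_rank_lower_bound[OF assms, where \<C> = "range (\<lambda>(p, p0). split_set p p0)"])
    show "split_closure P = (\<Inter>C\<in>range (\<lambda>(p, p0). split_set p p0). convex hull (P - C))"
      for P :: "(real ^ 'n) set"
      by (auto simp: split_closure_def)
  qed (use split_set_int_points split_scaling in auto)
  moreover have "u / ereal (log 2 2) = u" for u by (simp flip: one_ereal_def)
  ultimately show "ereal_of_enat (closure_rank split_closure Q) \<ge>
      (SUP c\<in>{c. 0 \<le> c}. ceiling_ereal (log2_ereal (zLP Q c / zI Q c)))"
    by simp
next
  fix k :: nat
  define \<C> :: "(real ^ 'n) set set" where
    "\<C> = range (\<lambda>(p, p0). \<Union>i\<in>{1..k}. split_set (p i) (p0 i))"
  show "ereal_of_enat (closure_rank (branch_split_closure k) Q) \<ge>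
      (SUP c\<in>{c. 0 \<le> c}. ceiling_ereal (log2_ereal (zLP Q c / zI Q c) /
        ereal (log 2 (real (min (2 ^ k) CARD('n)) + 1))))"
  proof (rule closure_rank_lower_bound[OF assms])
    show "branch_split_closure k P = (\<Inter>C\<in>\<C>. convex hull (P - C))" for P
      by (auto simp: branch_split_closure_def \<C>_def)
    show "C \<inter> int_points = {}" if "C \<in> \<C>" for C
      using that split_set_int_points by (fastforce simp: \<C>_def)
    show "(1 / (real (min (2 ^ k) CARD('n)) + 1)) *\<^sub>R z \<in> convex hull (P - C)"
      if "packing_set P" "well_behaved P" "z \<in> P" "C \<in> \<C>" for P C z
      using that(4) branch_split_scaling[OF that(1-3)] by (auto simp: \<C>_def)
  qed simp
next
  fix k :: nat
  assume "k \<ge> 2"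
  show "ereal_of_enat (closure_rank (lattice_free_closure k) Q) \<ge>
      (SUP c\<in>{c. 0 \<le> c}. ceiling_ereal (log2_ereal (zLP Q c / zI Q c) /
        ereal (log 2 (real (min k CARD('n)) + 1))))"
  proof (rule closure_rank_lower_bound[OF assms,
        where \<C> = "interior ` {L. lattice_free_polyhedron k L}"])
    show "(1 / (real (min k CARD('n)) + 1)) *\<^sub>R z \<in> convex hull (P - C)"
      if "packing_set P" "well_behaved P" "z \<in> P"
        "C \<in> interior ` {L. lattice_free_polyhedron k L}" for P C and z :: "real ^ 'n"
      using that(4) lattice_free_polyhedron_scaling[OF that(1-3)] by auto
  qed (use \<open>k \<ge> 2\<close> in \<open>auto simp: lattice_free_closure_def lattice_free_polyhedron_def\<close>)
qed

end
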